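(* A near prequantale $Q$ is simple if and only if, for any $x,y,a \in Q$ with $a < \bigvee Q$, one has: $x \leq y$ if and only if for all $f \in \operatorname{Lin}(Q)$, $f(y) \leq a$ implies $f(x) \leq a$.
   Context: An ordered magma is a set with a binary operation (written multiplicatively) and a partial order such that $x\le x'$, $y \le y'$ imply $xy \le x'y'$. A near sup-magma is an ordered magma in which every nonempty subset has a supremum. A near prequantale is a near sup-magma $Q$ such that $a(\bigvee X) = \bigvee(aX)$ and $(\bigvee X)a = \bigvee(Xa)$ for every $a \in Q$ and every nonempty $X\subseteq Q$. A map $f$ between near sup-magmas is near sup-preserving if $f(\bigvee X)=\bigvee f(X)$ for every nonempty subset $X$. A near sup-magma $M$ is simple if every nonconstant near sup-preserving magma homomorphism from $M$ to a near sup-magma is injective. For a magma $M$ and $r\in M$, the translations $L_r,R_r$ are the self-maps $L_r(x)=rx$, $R_r(x)=xr$ of $M$; $\operatorname{Lin}(M)$ is the submonoid (containing the identity map) of the monoid of all self-maps of $M$ under composition generated by all translations. *)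

theory Defs
  imports "HOL-Algebra.Lattice"
begin

text \<open>
  Structures are carrier-based, on top of the order records of HOL-Algebra (where
  \<^locale>\<open>partial_order\<close> forces the \<open>eq\<close> field to be equality). Carriers may be empty.
\<close>

record 'a omagma = "'a gorder" +
  omult :: "['a, 'a] \<Rightarrow> 'a"  (infixl "\<cdot>\<index>" 70)

locale ordered_magma = partial_order M for M :: "'a omagma" (structure) +
  assumes omult_closed:
    "\<lbrakk>x \<in> carrier M; y \<in> carrier M\<rbrakk> \<Longrightarrow> x \<cdot> y \<in> carrier M"
  and omult_mono:
    "\<lbrakk>x \<in> carrier M; x' \<in> carrier M; y \<in> carrier M; y' \<in> carrier M; x \<sqsubseteq> x'; y \<sqsubseteq> y'\<rbrakk>
      \<Longrightarrow> x \<cdot> y \<sqsubseteq> x' \<cdot> y'"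

locale near_sup_magma = ordered_magma +
  assumes nonempty_sup_exists:
    "\<lbrakk>X \<subseteq> carrier M; X \<noteq> {}\<rbrakk> \<Longrightarrow> \<exists>s. least M s (Upper M X)"

locale near_prequantale = near_sup_magma +
  assumes omult_sup_left:
    "\<lbrakk>a \<in> carrier M; X \<subseteq> carrier M; X \<noteq> {}\<rbrakk> \<Longrightarrow> a \<cdot> \<Squnion>X = \<Squnion>((\<lambda>x. a \<cdot> x) ` X)"
  and omult_sup_right:
    "\<lbrakk>a \<in> carrier M; X \<subseteq> carrier M; X \<noteq> {}\<rbrakk> \<Longrightarrow> \<Squnion>X \<cdot> a = \<Squnion>((\<lambda>x. x \<cdot> a) ` X)"

definition magma_hom :: "'a omagma \<Rightarrow> 'b omagma \<Rightarrow> ('a \<Rightarrow> 'b) set" where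
  "magma_hom M N = {f \<in> carrier M \<rightarrow> carrier N.
     \<forall>x\<in>carrier M. \<forall>y\<in>carrier M. f (x \<cdot>\<^bsub>M\<^esub> y) = f x \<cdot>\<^bsub>N\<^esub> f y}"

definition near_sup_preserving :: "'a omagma \<Rightarrow> 'b omagma \<Rightarrow> ('a \<Rightarrow> 'b) \<Rightarrow> bool" where
  "near_sup_preserving M N f \<longleftrightarrow>
     (\<forall>X. X \<subseteq> carrier M \<and> X \<noteq> {} \<longrightarrow> f (\<Squnion>\<^bsub>M\<^esub> X) = \<Squnion>\<^bsub>N\<^esub> (f ` X))"

text \<open>
  A definition in HOL cannot quantify over all types, so simplicity carries the type \<open>'b\<close> in
  which the carriers of the codomains live. The codomains are all near sup-magmas whose carrier
  is any subset of \<open>'b\<close>.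
\<close>

definition simple_near_sup_magma :: "'b itself \<Rightarrow> 'a omagma \<Rightarrow> bool" where
  "simple_near_sup_magma T M \<longleftrightarrow>
     (\<forall>(N :: 'b omagma) f. near_sup_magma N \<and> f \<in> magma_hom M N \<and> near_sup_preserving M N f \<and>
        (\<exists>x\<in>carrier M. \<exists>y\<in>carrier M. f x \<noteq> f y) \<longrightarrow> inj_on f (carrier M))"

text \<open>
  Self-maps of \<open>M\<close> are represented by extensional functions on the carrier.
\<close>

inductive_set Lin :: "'a omagma \<Rightarrow> ('a \<Rightarrow> 'a) set" for M :: "'a omagma" where
  Lin_id: "(\<lambda>x\<in>carrier M. x) \<in> Lin M"
| Lin_left: "r \<in> carrier M \<Longrightarrow> (\<lambda>x\<in>carrier M. r \<cdot>\<^bsub>M\<^esub> x) \<in> Lin M"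
| Lin_right: "r \<in> carrier M \<Longrightarrow> (\<lambda>x\<in>carrier M. x \<cdot>\<^bsub>M\<^esub> r) \<in> Lin M"
| Lin_comp: "\<lbrakk>f \<in> Lin M; g \<in> Lin M\<rbrakk> \<Longrightarrow> compose (carrier M) f g \<in> Lin M"

end

theory Submission
  imports Defs
begin

text \<open>
  For \<open>a\<close> strictly below the top, put \<open>x \<preceq> y\<close> when every \<open>f \<in> Lin Q\<close> with \<open>f y \<le> a\<close> has
  \<open>f x \<le> a\<close>. Each \<open>f\<close> preserves nonempty suprema, so \<open>x \<mapsto> \<Squnion>{y. y \<preceq> x}\<close> is a nucleus fixing
  \<open>a\<close> and the top. Its image is a near sup-magma and the nucleus is a nonconstant homomorphism
  onto it; simplicity makes the nucleus injective, which collapses \<open>\<preceq>\<close> to \<open>\<le>\<close>. Conversely, a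
  nonconstant homomorphism \<open>h\<close> has some \<open>h z \<noteq> h \<top>\<close>, and then \<open>a = \<Squnion>{w. h w \<le> h z}\<close> lies
  strictly below the top. Since \<open>w \<le> a\<close> is equivalent to \<open>h w \<le> h z\<close>, elements with equal
  images under \<open>h\<close> cannot be separated by \<open>Lin Q\<close> and \<open>a\<close>.
\<close>

section \<open>Suprema of nonempty subsets, and monotonicity of maps preserving them\<close>

context near_sup_magma
begin

lemma sup_least:
  assumes "X \<subseteq> carrier M" "X \<noteq> {}"
  shows "least M (\<Squnion>X) (Upper M X)"
  unfolding sup_def using nonempty_sup_exists[OF assms] by (rule someI_ex)

lemma sup_in_carrier:
  assumes "X \<subseteq> carrier M" "X \<noteq> {}"
  shows "\<Squnion>X \<in> carrier M"
  using least_closed[OF sup_least[OF assms]] .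

lemma sup_ge:
  assumes "X \<subseteq> carrier M" "x \<in> X"
  shows "x \<sqsubseteq> \<Squnion>X"
  using least_Upper_above[OF sup_least[of X], of x] assms by blast

lemma sup_le:
  assumes "X \<subseteq> carrier M" "X \<noteq> {}" "u \<in> carrier M" "\<And>x. x \<in> X \<Longrightarrow> x \<sqsubseteq> u"
  shows "\<Squnion>X \<sqsubseteq> u"
  using least_le[OF sup_least[OF assms(1,2)] Upper_memI[OF assms(4,3)]] .

lemma sup_eqI:
  assumes "X \<subseteq> carrier M" "X \<noteq> {}" "u \<in> carrier M" "\<And>x. x \<in> X \<Longrightarrow> x \<sqsubseteq> u"
    and "\<And>v. v \<in> carrier M \<Longrightarrow> (\<And>x. x \<in> X \<Longrightarrow> x \<sqsubseteq> v) \<Longrightarrow> u \<sqsubseteq> v"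
  shows "\<Squnion>X = u"
proof (rule le_antisym)
  show "u \<sqsubseteq> \<Squnion>X"
    using assms(1,2) by (intro assms(5) sup_in_carrier sup_ge)
qed (use assms in \<open>simp_all add: sup_le sup_in_carrier\<close>)

lemma sup_pair_eq:
  assumes "x \<in> carrier M" "y \<in> carrier M" "x \<sqsubseteq> y"
  shows "\<Squnion>{x, y} = y"
  using assms by (intro sup_eqI) auto

end

text \<open>If \<open>x\<close> is below \<open>y\<close>, then \<open>y\<close> is the supremum of
  \<open>{x, y}\<close>, so preserving two-element suprema already forces monotonicity.\<close>

lemma near_sup_preserving_mono:
  assumes M: "near_sup_magma M" and N: "near_sup_magma N"
    and h: "h \<in> carrier M \<rightarrow> carrier N" "near_sup_preserving M N h"
    and xy: "x \<in> carrier M" "y \<in> carrier M" "x \<sqsubseteq>\<^bsub>M\<^esub> y"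
  shows "h x \<sqsubseteq>\<^bsub>N\<^esub> h y"
proof -
  have "h y = h (\<Squnion>\<^bsub>M\<^esub> {x, y})"
    using near_sup_magma.sup_pair_eq[OF M xy] by simp
  also have "\<dots> = \<Squnion>\<^bsub>N\<^esub> {h x, h y}"
    using h(2) xy by (simp add: near_sup_preserving_def)
  finally show ?thesis
    using near_sup_magma.sup_ge[OF N, of "{h x, h y}" "h x"] h(1) xy by auto
qed

section \<open>Order, suprema and homomorphisms under the maps in \<open>Lin\<close>\<close>

lemma (in ordered_magma) Lin_funcset:
  assumes "f \<in> Lin M"
  shows "f \<in> carrier M \<rightarrow> carrier M"
  using assms by induction (auto simp: omult_closed compose_def)

lemma (in ordered_magma) Lin_mono:
  assumes "f \<in> Lin M" "x \<in> carrier M" "y \<in> carrier M" "x \<sqsubseteq> y"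
  shows "f x \<sqsubseteq> f y"
  using assms
  by (induction arbitrary: x y)
    (use Lin_funcset in \<open>auto simp: compose_def Pi_iff intro!: omult_mono\<close>)

text \<open>Translations preserve nonempty suprema by the two distributive laws, and composition
  keeps the property.\<close>

lemma (in near_prequantale) Lin_sup:
  assumes "f \<in> Lin M" "X \<subseteq> carrier M" "X \<noteq> {}"
  shows "f (\<Squnion>X) = \<Squnion>(f ` X)"
  using assms
proof (induction arbitrary: X)
  case Lin_id
  then have "(\<lambda>x\<in>carrier M. x) ` X = X"
    by (force simp: subset_iff)
  then show ?case using Lin_id sup_in_carrier by simp
next
  case (Lin_left r)
  then have "(\<lambda>x\<in>carrier M. r \<cdot> x) ` X = (\<lambda>x. r \<cdot> x) ` X"
    by (intro image_cong) auto
  then show ?case using Lin_left sup_in_carrier omult_sup_left by simp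
next
  case (Lin_right r)
  then have "(\<lambda>x\<in>carrier M. x \<cdot> r) ` X = (\<lambda>x. x \<cdot> r) ` X"
    by (intro image_cong) auto
  then show ?case using Lin_right sup_in_carrier omult_sup_right by simp
next
  case (Lin_comp f g)
  have "compose (carrier M) f g ` X = f ` g ` X"
    using Lin_comp.prems unfolding image_image by (intro image_cong) (auto simp: compose_def)
  moreover have "g ` X \<subseteq> carrier M"
    using Lin_funcset[OF Lin_comp.hyps(2)] Lin_comp.prems by auto
  ultimately show ?case
    using Lin_comp.IH Lin_comp.prems sup_in_carrier by (simp add: compose_def)
qed

text \<open>The kernel of a homomorphism is a congruence, hence stable under translations and their
  composites.\<close>

lemma magma_hom_Lin_cong:
  assumes M: "ordered_magma M" and h: "h \<in> magma_hom M N" and f: "f \<in> Lin M"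
    and "x \<in> carrier M" "y \<in> carrier M" "h x = h y"
  shows "h (f x) = h (f y)"
proof -
  have hom: "h (x \<cdot>\<^bsub>M\<^esub> y) = h x \<cdot>\<^bsub>N\<^esub> h y" if "x \<in> carrier M" "y \<in> carrier M" for x y
    using h that by (simp add: magma_hom_def)
  show ?thesis
    using f assms(4-)
  proof (induction arbitrary: x y)
    case (Lin_comp f g)
    have "g x \<in> carrier M" "g y \<in> carrier M"
      using ordered_magma.Lin_funcset[OF M Lin_comp.hyps(2)] Lin_comp.prems by auto
    then have "h (f (g x)) = h (f (g y))"
      by (rule Lin_comp.IH(1)) (rule Lin_comp.IH(2)[OF Lin_comp.prems])
    then show ?case
      using Lin_comp.prems(1,2) by (simp add: compose_def)
  qed (simp_all add: hom)
qed

section \<open>The syntactic preorder \<preceq> of the down-set of \<open>a\<close>, with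
  \<open>Lin\<close> as contexts, and its closure operator\<close>

definition Lin_le :: "'a omagma \<Rightarrow> 'a \<Rightarrow> 'a \<Rightarrow> 'a \<Rightarrow> bool" where
  "Lin_le Q a x y \<longleftrightarrow> (\<forall>f\<in>Lin Q. f y \<sqsubseteq>\<^bsub>Q\<^esub> a \<longrightarrow> f x \<sqsubseteq>\<^bsub>Q\<^esub> a)"

lemma Lin_le_refl: "Lin_le Q a x x"
  by (simp add: Lin_le_def)

lemma Lin_le_trans: "Lin_le Q a x y \<Longrightarrow> Lin_le Q a y z \<Longrightarrow> Lin_le Q a x z"
  by (simp add: Lin_le_def)

text \<open>For \<open>x\<close> and \<open>a\<close> in the carrier of a near prequantale, the set
  joined here contains \<open>x\<close> and its own supremum, so the value is the greatest element
  \<preceq>-equivalent to \<open>x\<close>: a canonical representative of its class.\<close>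

definition Lin_closure :: "'a omagma \<Rightarrow> 'a \<Rightarrow> 'a \<Rightarrow> 'a" where
  "Lin_closure Q a x = \<Squnion>\<^bsub>Q\<^esub> {y \<in> carrier Q. Lin_le Q a y x}"

text \<open>
  The quotient by the equivalence of \<open>\<preceq>\<close> is realised on canonical representatives, so that it
  lives in the type of \<open>Q\<close> and simplicity at that type applies to it.
\<close>

definition Lin_quotient :: "'a omagma \<Rightarrow> 'a \<Rightarrow> 'a omagma" where
  "Lin_quotient Q a = \<lparr>carrier = Lin_closure Q a ` carrier Q, eq = (=), le = le Q,
     omult = (\<lambda>x y. Lin_closure Q a (x \<cdot>\<^bsub>Q\<^esub> y))\<rparr>"

context near_prequantale
begin

lemma le_imp_Lin_le:
  assumes "x \<in> carrier M" "y \<in> carrier M" "a \<in> carrier M" "x \<sqsubseteq> y"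
  shows "Lin_le M a x y"
  unfolding Lin_le_def
proof (intro ballI impI)
  fix f assume f: "f \<in> Lin M" "f y \<sqsubseteq> a"
  then show "f x \<sqsubseteq> a"
    using le_trans[OF Lin_mono[OF f(1) assms(1,2,4)] f(2)] Lin_funcset[OF f(1)] assms by auto
qed

text \<open>Each test map sends \<open>\<Squnion>X\<close> to the supremum of the images of
  \<open>X\<close>, and these are all below \<open>a\<close> once \<open>f y\<close> is.\<close>

lemma sup_Lin_le:
  assumes "X \<subseteq> carrier M" "X \<noteq> {}" "a \<in> carrier M" "\<And>x. x \<in> X \<Longrightarrow> Lin_le M a x y"
  shows "Lin_le M a (\<Squnion>X) y"
  unfolding Lin_le_def
proof (intro ballI impI)
  fix f assume f: "f \<in> Lin M" "f y \<sqsubseteq> a"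
  have "f ` X \<subseteq> carrier M"
    using Lin_funcset[OF f(1)] assms(1) by auto
  then show "f (\<Squnion>X) \<sqsubseteq> a"
    using f assms by (auto simp: Lin_sup Lin_le_def intro!: sup_le)
qed

text \<open>Precomposing a test map with a left translation gives another test map.\<close>

lemma Lin_le_mult_left:
  assumes "x \<in> carrier M" "y \<in> carrier M" "r \<in> carrier M" "Lin_le M a x y"
  shows "Lin_le M a (r \<cdot> x) (r \<cdot> y)"
  unfolding Lin_le_def
proof
  fix f assume "f \<in> Lin M"
  then have "compose (carrier M) f (\<lambda>x\<in>carrier M. r \<cdot> x) \<in> Lin M"
    using assms by (intro Lin.intros)
  with assms show "f (r \<cdot> y) \<sqsubseteq> a \<longrightarrow> f (r \<cdot> x) \<sqsubseteq> a"
    by (force simp: Lin_le_def compose_def)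
qed

lemma Lin_le_mult_right:
  assumes "x \<in> carrier M" "y \<in> carrier M" "r \<in> carrier M" "Lin_le M a x y"
  shows "Lin_le M a (x \<cdot> r) (y \<cdot> r)"
  unfolding Lin_le_def
proof
  fix f assume "f \<in> Lin M"
  then have "compose (carrier M) f (\<lambda>x\<in>carrier M. x \<cdot> r) \<in> Lin M"
    using assms by (intro Lin.intros)
  with assms show "f (y \<cdot> r) \<sqsubseteq> a \<longrightarrow> f (x \<cdot> r) \<sqsubseteq> a"
    by (force simp: Lin_le_def compose_def)
qed

lemma Lin_le_mult:
  assumes "x \<in> carrier M" "x' \<in> carrier M" "y \<in> carrier M" "y' \<in> carrier M"
    and "Lin_le M a x x'" "Lin_le M a y y'"
  shows "Lin_le M a (x \<cdot> y) (x' \<cdot> y')"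
  using Lin_le_trans Lin_le_mult_left Lin_le_mult_right assms by metis

context
  fixes a assumes a: "a \<in> carrier M"
begin

lemma Lin_closure_closed: "x \<in> carrier M \<Longrightarrow> Lin_closure M a x \<in> carrier M"
  unfolding Lin_closure_def by (intro sup_in_carrier) (auto intro: exI[of _ x] Lin_le_refl)

lemma Lin_closure_Lin_le: "x \<in> carrier M \<Longrightarrow> Lin_le M a (Lin_closure M a x) x"
  unfolding Lin_closure_def using a by (intro sup_Lin_le) (auto intro: exI[of _ x] Lin_le_refl)

text \<open>Forward, \<le> implies \<preceq> and the closure of \<open>y\<close> is \<preceq>
  \<open>y\<close>; backward, \<open>x\<close> is one of the elements joined in the closure.\<close>

lemma le_Lin_closure_iff:
  assumes "x \<in> carrier M" "y \<in> carrier M"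
  shows "x \<sqsubseteq> Lin_closure M a y \<longleftrightarrow> Lin_le M a x y"
proof
  assume "x \<sqsubseteq> Lin_closure M a y"
  then show "Lin_le M a x y"
    using Lin_le_trans[OF le_imp_Lin_le Lin_closure_Lin_le] assms a Lin_closure_closed by blast
next
  assume "Lin_le M a x y"
  then show "x \<sqsubseteq> Lin_closure M a y"
    unfolding Lin_closure_def using assms by (intro sup_ge) auto
qed

lemma Lin_le_Lin_closure:
  assumes "x \<in> carrier M"
  shows "Lin_le M a x (Lin_closure M a x)"
  using assms a
  by (intro le_imp_Lin_le le_Lin_closure_iff[THEN iffD2] Lin_closure_closed Lin_le_refl)

text \<open>An element and its closure are \<preceq>-equivalent. This turns order statements in the
  quotient into statements about \<preceq>.\<close>

lemma Lin_closure_le_iff: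
  assumes "x \<in> carrier M" "y \<in> carrier M"
  shows "Lin_closure M a x \<sqsubseteq> Lin_closure M a y \<longleftrightarrow> Lin_le M a x y"
proof -
  have "Lin_le M a (Lin_closure M a x) y \<longleftrightarrow> Lin_le M a x y"
    using Lin_le_trans[OF Lin_le_Lin_closure[OF assms(1)]]
      Lin_le_trans[OF Lin_closure_Lin_le[OF assms(1)]] by blast
  then show ?thesis
    using assms by (simp add: le_Lin_closure_iff Lin_closure_closed)
qed

lemma Lin_closure_eqI:
  assumes "x \<in> carrier M" "y \<in> carrier M" "Lin_le M a x y" "Lin_le M a y x"
  shows "Lin_closure M a x = Lin_closure M a y"
  using assms by (intro le_antisym) (simp_all add: Lin_closure_le_iff Lin_closure_closed)

lemma Lin_closure_idem:
  assumes "x \<in> carrier M"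
  shows "Lin_closure M a (Lin_closure M a x) = Lin_closure M a x"
  using assms
  by (intro Lin_closure_eqI Lin_closure_closed Lin_closure_Lin_le Lin_le_Lin_closure)

lemma Lin_closure_mult:
  assumes "x \<in> carrier M" "y \<in> carrier M"
  shows "Lin_closure M a (Lin_closure M a x \<cdot> Lin_closure M a y) = Lin_closure M a (x \<cdot> y)"
  using assms
  by (intro Lin_closure_eqI Lin_le_mult omult_closed Lin_closure_closed Lin_closure_Lin_le
      Lin_le_Lin_closure)

lemma Lin_closure_fixed: "Lin_closure M a a = a"
proof (rule le_antisym)
  \<comment> \<open>Testing with the identity map turns \<preceq> \<open>a\<close> into \<le>
    \<open>a\<close>.\<close>
  have "(\<lambda>x\<in>carrier M. x) \<in> Lin M"
    by (rule Lin_id)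
  then show "Lin_closure M a a \<sqsubseteq> a"
    using Lin_closure_Lin_le[OF a] Lin_closure_closed[OF a] a by (force simp: Lin_le_def)
qed (use a Lin_closure_closed le_Lin_closure_iff Lin_le_refl in auto)

section \<open>The quotient as a near sup-magma and the closure as a homomorphism onto it\<close>

lemma Lin_closure_sup_least:
  assumes "X \<subseteq> carrier M" "X \<noteq> {}"
  shows "least (Lin_quotient M a) (Lin_closure M a (\<Squnion>X))
    (Upper (Lin_quotient M a) (Lin_closure M a ` X))"
proof (rule least_UpperI)
  fix z assume "z \<in> Lin_closure M a ` X"
  then obtain x where "x \<in> X" "z = Lin_closure M a x"
    by blast
  moreover have "Lin_le M a x (\<Squnion>X)"
    using \<open>x \<in> X\<close> assms a by (intro le_imp_Lin_le sup_ge sup_in_carrier) auto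
  ultimately show "z \<sqsubseteq>\<^bsub>Lin_quotient M a\<^esub> Lin_closure M a (\<Squnion>X)"
    using assms sup_in_carrier[OF assms] by (simp add: Lin_quotient_def Lin_closure_le_iff subsetD)
next
  fix z assume z: "z \<in> Upper (Lin_quotient M a) (Lin_closure M a ` X)"
  then obtain y where y: "y \<in> carrier M" "z = Lin_closure M a y"
    by (auto simp: Upper_def Lin_quotient_def)
  \<comment> \<open>The upper bound is the closure of \<open>y\<close>, and bounding the closure of
    \<open>x\<close> by it amounts to \<open>x\<close> \<preceq> \<open>y\<close>; leastness thus
    reduces to \<open>sup_Lin_le\<close>.\<close>
  have "Lin_le M a x y" if "x \<in> X" for x
  proof -
    have "x \<in> carrier M" using that assms(1) by blast
    moreover have "Lin_closure M a x \<sqsubseteq> Lin_closure M a y"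
      using z that \<open>x \<in> carrier M\<close> unfolding y(2) by (simp add: Upper_def Lin_quotient_def)
    ultimately show ?thesis
      using y(1) Lin_closure_le_iff by simp
  qed
  then have "Lin_le M a (\<Squnion>X) y"
    using assms a by (intro sup_Lin_le)
  then show "Lin_closure M a (\<Squnion>X) \<sqsubseteq>\<^bsub>Lin_quotient M a\<^esub> z"
    using y sup_in_carrier[OF assms] by (simp add: Lin_quotient_def Lin_closure_le_iff)
qed (use assms sup_in_carrier[OF assms] in \<open>auto simp: Lin_quotient_def\<close>)

lemma near_sup_magma_Lin_quotient: "near_sup_magma (Lin_quotient M a)"
proof unfold_locales
  fix X assume X: "X \<subseteq> carrier (Lin_quotient M a)" "X \<noteq> {}"
  then obtain Y where "Y \<subseteq> carrier M" "X = Lin_closure M a ` Y"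
    by (auto simp: Lin_quotient_def subset_image_iff)
  then show "\<exists>s. least (Lin_quotient M a) s (Upper (Lin_quotient M a) X)"
    using X Lin_closure_sup_least by blast
next
  fix x y z assume "x \<in> carrier (Lin_quotient M a)" "y \<in> carrier (Lin_quotient M a)"
    "z \<in> carrier (Lin_quotient M a)" "x \<sqsubseteq>\<^bsub>Lin_quotient M a\<^esub> y" "y \<sqsubseteq>\<^bsub>Lin_quotient M a\<^esub> z"
  then show "x \<sqsubseteq>\<^bsub>Lin_quotient M a\<^esub> z"
    by (auto simp: Lin_quotient_def Lin_closure_le_iff intro: Lin_le_trans)
next
  fix x y x' y'
  assume "x \<in> carrier (Lin_quotient M a)" "x' \<in> carrier (Lin_quotient M a)"
    "y \<in> carrier (Lin_quotient M a)" "y' \<in> carrier (Lin_quotient M a)"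
    "x \<sqsubseteq>\<^bsub>Lin_quotient M a\<^esub> x'" "y \<sqsubseteq>\<^bsub>Lin_quotient M a\<^esub> y'"
  then show "x \<cdot>\<^bsub>Lin_quotient M a\<^esub> y \<sqsubseteq>\<^bsub>Lin_quotient M a\<^esub> x' \<cdot>\<^bsub>Lin_quotient M a\<^esub> y'"
    by (auto simp: Lin_quotient_def Lin_closure_mult omult_closed Lin_closure_le_iff
        intro: Lin_le_mult)
qed (auto simp: Lin_quotient_def Lin_closure_closed omult_closed intro: le_antisym)

lemma Lin_closure_hom: "Lin_closure M a \<in> magma_hom M (Lin_quotient M a)"
  by (auto simp: magma_hom_def Lin_quotient_def Lin_closure_mult)

lemma Lin_closure_near_sup_preserving:
  "near_sup_preserving M (Lin_quotient M a) (Lin_closure M a)"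
  unfolding near_sup_preserving_def
proof (intro allI impI)
  interpret N: near_sup_magma "Lin_quotient M a"
    by (rule near_sup_magma_Lin_quotient)
  fix X assume X: "X \<subseteq> carrier M \<and> X \<noteq> {}"
  then have "Lin_closure M a ` X \<subseteq> carrier (Lin_quotient M a)" "Lin_closure M a ` X \<noteq> {}"
    by (auto simp: Lin_quotient_def)
  \<comment> \<open>The supremum in the quotient is a choice among least upper bounds; their
    uniqueness identifies it with the closure of \<open>\<Squnion>X\<close>.\<close>
  then have "least (Lin_quotient M a) (\<Squnion>\<^bsub>Lin_quotient M a\<^esub> (Lin_closure M a ` X))
      (Upper (Lin_quotient M a) (Lin_closure M a ` X))"
    by (rule N.sup_least)
  with Lin_closure_sup_least[of X] X
  show "Lin_closure M a (\<Squnion>X) = \<Squnion>\<^bsub>Lin_quotient M a\<^esub> (Lin_closure M a ` X)"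
    using N.weak_least_unique unfolding N.eq_is_equal by blast
qed

end

section \<open>The two directions of the equivalence\<close>

lemma simple_imp_Lin_le_iff:
  assumes simple: "simple_near_sup_magma TYPE('a) M"
    and a: "a \<in> carrier M" "a \<noteq> \<Squnion>(carrier M)"
    and xy: "x \<in> carrier M" "y \<in> carrier M"
  shows "x \<sqsubseteq> y \<longleftrightarrow> Lin_le M a x y"
proof
  assume "Lin_le M a x y"
  define t where "t = \<Squnion>(carrier M)"
  have t: "t \<in> carrier M"
    unfolding t_def using a by (intro sup_in_carrier) auto
  \<comment> \<open>The closure is inflationary, so it fixes the top element
    \<open>t\<close>.\<close>
  have "t \<sqsubseteq> Lin_closure M a t"
    using t a le_Lin_closure_iff Lin_le_refl by auto
  moreover have "Lin_closure M a t \<sqsubseteq> t"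
    unfolding t_def using t a Lin_closure_closed by (intro sup_ge) (auto simp: t_def)
  ultimately have "Lin_closure M a t = t"
    using t a Lin_closure_closed le_antisym by auto
  \<comment> \<open>Both \<open>a\<close> and \<open>t\<close> are fixed and they differ, so the
    closure is nonconstant and simplicity applies.\<close>
  then have "Lin_closure M a a \<noteq> Lin_closure M a t"
    using Lin_closure_fixed a by (simp add: t_def)
  then have inj: "inj_on (Lin_closure M a) (carrier M)"
    using simple[unfolded simple_near_sup_magma_def, rule_format,
        of "Lin_quotient M a" "Lin_closure M a"]
      near_sup_magma_Lin_quotient[OF a(1)] Lin_closure_hom[OF a(1)]
      Lin_closure_near_sup_preserving[OF a(1)] a(1) t by blast
  \<comment> \<open>By idempotence \<open>y\<close> and its closure have the same image, and
    injectivity identifies them.\<close>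
  have "Lin_closure M a y = y"
    by (rule inj_onD[OF inj Lin_closure_idem[OF a(1) xy(2)] Lin_closure_closed[OF a(1) xy(2)] xy(2)])
  with \<open>Lin_le M a x y\<close> show "x \<sqsubseteq> y"
    using le_Lin_closure_iff[OF a(1) xy] by simp
qed (use le_imp_Lin_le a xy in auto)

text \<open>The codomain type \<open>'b\<close> is left free so that the result can be used at
  several types.\<close>

lemma Lin_le_imp_simple:
  assumes sep: "\<And>x y a. x \<in> carrier M \<Longrightarrow> y \<in> carrier M \<Longrightarrow> a \<in> carrier M \<Longrightarrow>
      a \<sqsubset> \<Squnion>(carrier M) \<Longrightarrow> Lin_le M a x y \<Longrightarrow> x \<sqsubseteq> y"
  shows "simple_near_sup_magma TYPE('b) M"
  unfolding simple_near_sup_magma_def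
proof (intro allI impI, elim conjE)
  fix N :: "'b omagma" and h
  assume N: "near_sup_magma N" and hom: "h \<in> magma_hom M N" and pres: "near_sup_preserving M N h"
    and "\<exists>x\<in>carrier M. \<exists>y\<in>carrier M. h x \<noteq> h y"
  interpret N: near_sup_magma N by (rule N)
  define t where "t = \<Squnion>(carrier M)"
  \<comment> \<open>If every value of \<open>h\<close> equalled \<open>h t\<close>, then
    \<open>h\<close> would be constant.\<close>
  obtain z where z: "z \<in> carrier M" "h z \<noteq> h t"
    using \<open>\<exists>x\<in>carrier M. \<exists>y\<in>carrier M. h x \<noteq> h y\<close> by metis
  have h: "h \<in> carrier M \<rightarrow> carrier N"
    using hom by (simp add: magma_hom_def)
  note mono = near_sup_preserving_mono[OF near_sup_magma_axioms N h pres]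
  define W where "W = {w \<in> carrier M. h w \<sqsubseteq>\<^bsub>N\<^esub> h z}"
  define a where "a = \<Squnion>W"
  have W: "W \<subseteq> carrier M" "W \<noteq> {}"
    using z N.le_refl[OF funcset_mem[OF h z(1)]] by (auto simp: W_def)
  then have a: "a \<in> carrier M"
    unfolding a_def by (rule sup_in_carrier)
  \<comment> \<open>Since \<open>h\<close> preserves this supremum, \<open>a\<close> itself lies in
    \<open>W\<close> and is its greatest element.\<close>
  have "h a = \<Squnion>\<^bsub>N\<^esub> (h ` W)"
    using pres W by (simp add: a_def near_sup_preserving_def)
  then have "h a \<sqsubseteq>\<^bsub>N\<^esub> h z"
    using W h z by (auto simp: W_def intro!: N.sup_le)
  have le_a_iff: "w \<sqsubseteq> a \<longleftrightarrow> h w \<sqsubseteq>\<^bsub>N\<^esub> h z" if w: "w \<in> carrier M" for w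
  proof
    assume "w \<sqsubseteq> a"
    then show "h w \<sqsubseteq>\<^bsub>N\<^esub> h z"
      using N.le_trans[OF mono[OF w a] \<open>h a \<sqsubseteq>\<^bsub>N\<^esub> h z\<close>] w a z h by auto
  next
    assume "h w \<sqsubseteq>\<^bsub>N\<^esub> h z"
    then show "w \<sqsubseteq> a"
      unfolding a_def using w W by (intro sup_ge) (auto simp: W_def)
  qed
  have t: "t \<in> carrier M"
    unfolding t_def using z by (intro sup_in_carrier) auto
  have le_t: "x \<sqsubseteq> t" if "x \<in> carrier M" for x
    unfolding t_def using that by (intro sup_ge) auto
  have "a \<noteq> t"
  proof
    assume "a = t"
    then have "h t \<sqsubseteq>\<^bsub>N\<^esub> h z"
      using \<open>h a \<sqsubseteq>\<^bsub>N\<^esub> h z\<close> by simp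
    then show False
      using N.le_antisym[OF _ mono[OF z(1) t le_t[OF z(1)]]] z t h by auto
  qed
  then have "a \<sqsubset> \<Squnion>(carrier M)"
    using le_t[OF a] by (simp add: lless_eq t_def)
  \<comment> \<open>The images of \<open>f x\<close> and \<open>f y\<close> under \<open>h\<close>
    agree again, and by \<open>le_a_iff\<close> being below \<open>a\<close> depends only on that
    image.\<close>
  moreover have "Lin_le M a x y" if "x \<in> carrier M" "y \<in> carrier M" "h x = h y" for x y
    unfolding Lin_le_def
  proof (intro ballI impI)
    fix f assume "f \<in> Lin M" "f y \<sqsubseteq> a"
    then show "f x \<sqsubseteq> a"
      using magma_hom_Lin_cong[OF ordered_magma_axioms hom _ that] Lin_funcset[of f] that
      by (auto simp: le_a_iff Pi_iff)
  qed
  \<comment> \<open>The equation \<open>h x = h y\<close> is symmetric, so separation gives both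
    inequalities between \<open>x\<close> and \<open>y\<close>.\<close>
  ultimately show "inj_on h (carrier M)"
    using sep a by (intro inj_onI le_antisym) auto
qed

end

theorem corollary5p12:
  fixes Q :: "'a omagma"
  assumes "near_prequantale Q"
  shows "(simple_near_sup_magma TYPE('a) Q \<longleftrightarrow>
      (\<forall>x\<in>carrier Q. \<forall>y\<in>carrier Q. \<forall>a\<in>carrier Q. a \<sqsubset>\<^bsub>Q\<^esub> \<Squnion>\<^bsub>Q\<^esub> (carrier Q) \<longrightarrow>
        (x \<sqsubseteq>\<^bsub>Q\<^esub> y \<longleftrightarrow> (\<forall>f\<in>Lin Q. f y \<sqsubseteq>\<^bsub>Q\<^esub> a \<longrightarrow> f x \<sqsubseteq>\<^bsub>Q\<^esub> a))))
    \<and> (simple_near_sup_magma TYPE('a) Q \<longrightarrow> simple_near_sup_magma TYPE('b) Q)"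
proof -
  interpret near_prequantale Q by (rule assms)
  let ?sep = "\<forall>x\<in>carrier Q. \<forall>y\<in>carrier Q. \<forall>a\<in>carrier Q.
    a \<sqsubset>\<^bsub>Q\<^esub> \<Squnion>\<^bsub>Q\<^esub> (carrier Q) \<longrightarrow> (x \<sqsubseteq>\<^bsub>Q\<^esub> y \<longleftrightarrow> Lin_le Q a x y)"
  have "?sep" if "simple_near_sup_magma TYPE('a) Q"
    using simple_imp_Lin_le_iff[OF that] by (simp add: lless_eq)
  moreover have "simple_near_sup_magma TYPE('a) Q" if ?sep
    using that by (intro Lin_le_imp_simple) blast
  \<comment> \<open>The criterion speaks of \<open>Q\<close> alone, so it transfers simplicity from
    codomains in \<open>'a\<close> to codomains in \<open>'b\<close>.\<close>
  moreover have "simple_near_sup_magma TYPE('b) Q" if ?sep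
    using that by (intro Lin_le_imp_simple) blast
  ultimately show ?thesis
    unfolding Lin_le_def by blast
qed

end
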